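(* Let $n\ge 3$, $p>\frac{n}{n-2}$ and $\lambda>0$. Then there exist real numbers $a<b$, a potential $W\in C^2(\mathbb{R})$ satisfying $W'(a)=W'(b)=0$ and $W'<0$ on $(a,b)$, and a solution $u\in C^\infty(\mathbb{R}^n)$ to $\Delta u=W'(u)$ in $\mathbb{R}^n$, such that: a) $\lim_{s\to a^+}\frac{W'(s)}{|s-a|^p}=-\lambda$; b) $u$ is radial and radially decreasing, i.e. $u(x)=\tilde u(|x|)$ for a smooth decreasing function $\tilde u:[0,\infty)\to(a,b)$; c) $u(\mathbb{R}^n)\subset(a,b)$ and $\lim_{|x|\to\infty}u(x)=a$; d) $W''(u(0))>0$. *)

theory Defs
  imports "HOL-Analysis.Analysis"
begin

text \<open>
  Functions of class \<open>C\<^sup>k\<close> and \<open>C\<^sup>\<infinity>\<close> on \<open>S\<close>. The derivative is taken relative to \<open>S\<close>, so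
  the notion is meaningful for sets on which that derivative is unique: open sets (where it is the
  ordinary one) and nondegenerate intervals such as \<open>[0,\<infinity>)\<close>, where one-sided derivatives are used
  at the endpoints.
\<close>

primrec Ck_on :: "nat \<Rightarrow> 'a::real_normed_vector set \<Rightarrow> ('a \<Rightarrow> real) \<Rightarrow> bool" where
  "Ck_on 0 S f \<longleftrightarrow> continuous_on S f"
| "Ck_on (Suc k) S f \<longleftrightarrow>
     f differentiable_on S \<and> (\<forall>v. Ck_on k S (\<lambda>x. frechet_derivative f (at x within S) v))"

definition smooth_on :: "'a::real_normed_vector set \<Rightarrow> ('a \<Rightarrow> real) \<Rightarrow> bool" where
  "smooth_on S f \<longleftrightarrow> (\<forall>k. Ck_on k S f)"

definition partial_deriv :: "'a::euclidean_space \<Rightarrow> ('a \<Rightarrow> real) \<Rightarrow> 'a \<Rightarrow> real" where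
  "partial_deriv e f x = frechet_derivative f (at x) e"

definition laplacian :: "('a::euclidean_space \<Rightarrow> real) \<Rightarrow> 'a \<Rightarrow> real" where
  "laplacian f x = (\<Sum>e\<in>Basis. partial_deriv e (partial_deriv e f) x)"

end

theory Submission
  imports Defs
begin

text \<open>
  The solution is written down first and the potential is read off from it. With
  \<open>\<beta> = 1 / (p - 1)\<close> take \<open>u = k(z)\<close>, where \<open>z = 1 / (1 + |x|\<^sup>2)\<close> and
  \<open>k(z) = C (z\<^sup>\<beta> / \<beta> - \<epsilon> z\<^sup>\<beta>\<^sup>+\<^sup>1 / (\<beta> + 1))\<close>. Then \<open>\<Delta>u = h(z)\<close> is explicit;
  \<open>p > n / (n - 2)\<close> means \<open>2\<beta> + 2 < n\<close>, which makes \<open>h\<close> negative, and \<open>\<beta> p = \<beta> + 1\<close> gives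
  \<open>h \<sim> -\<lambda> k\<^sup>p\<close> as \<open>z \<rightarrow> 0\<close> for the right \<open>C\<close>. For \<open>\<epsilon> = 0\<close> the density \<open>-\<Delta>u\<close> would be
  largest at the origin; taking \<open>\<epsilon>\<close> close to 1 flattens \<open>u\<close> there and makes \<open>-\<Delta>u\<close>
  increase with \<open>|x|\<close> near the origin, that is, \<open>W''(u(0)) > 0\<close>. Finally \<open>W'' = h' / k'\<close>, as a function of
  \<open>s = k(z)\<close>, is continuous up to both ends of \<open>[0, u(0)]\<close>. Extending it by constants and
  integrating twice gives \<open>W\<close>: beyond \<open>u(0)\<close> the function \<open>W'\<close> is affine and increasing,
  and its zero is \<open>b\<close>.
\<close>

section \<open>Smoothness of the solution and of its radial profile\<close>

text \<open>A class closed under differentiation that contains both \<open>u\<close> and its radial profile.\<close>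

inductive bracket_polynomial :: "('a::real_inner \<Rightarrow> real) \<Rightarrow> bool" where
  const: "bracket_polynomial (\<lambda>x. c)"
| inner: "bracket_polynomial (\<lambda>x. x \<bullet> v)"
| powr: "bracket_polynomial (\<lambda>x. (1 + x \<bullet> x) powr s)"
| add: "bracket_polynomial f \<Longrightarrow> bracket_polynomial g \<Longrightarrow> bracket_polynomial (\<lambda>x. f x + g x)"
| mult: "bracket_polynomial f \<Longrightarrow> bracket_polynomial g \<Longrightarrow> bracket_polynomial (\<lambda>x. f x * g x)"

text \<open>Only the power case goes beyond the sum and product rules: its base is at least 1, so
  every real exponent is differentiable, and the chain rule gives an inner product times the power
  with exponent lowered by one.\<close>

lemma bracket_polynomial_has_derivative:
  assumes "bracket_polynomial f"
  shows "\<exists>D. \<forall>v. bracket_polynomial (D v) \<and> (\<forall>x. (f has_derivative (\<lambda>v. D v x)) (at x))"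
  using assms
proof induction
  case (const c)
  show ?case
    by (rule exI[of _ "\<lambda>v x. 0"]) (auto intro: bracket_polynomial.const)
next
  case (inner w)
  show ?case
    by (rule exI[of _ "\<lambda>v x. v \<bullet> w"])
      (auto intro: bracket_polynomial.const intro!: derivative_eq_intros)
next
  case (powr s)
  have pos: "1 + x \<bullet> x > 0" for x :: 'a
    by (simp add: add_pos_nonneg)
  have "((\<lambda>x. (1 + x \<bullet> x) powr s) has_derivative
      (\<lambda>v. (2 * s) * ((x \<bullet> v) * (1 + x \<bullet> x) powr (s - 1)))) (at x)" for x :: 'a
    using pos[of x]
    by (auto intro!: derivative_eq_intros
        simp: powr_diff field_simps inner_commute fun_eq_iff)
  then show ?case
    by (intro exI[of _ "\<lambda>v x. (2 * s) * ((x \<bullet> v) * (1 + x \<bullet> x) powr (s - 1))"])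
      (auto intro!: bracket_polynomial.intros)
next
  case (add f g)
  then obtain D E where
    "\<forall>v. bracket_polynomial (D v) \<and> (\<forall>x. (f has_derivative (\<lambda>v. D v x)) (at x))"
    "\<forall>v. bracket_polynomial (E v) \<and> (\<forall>x. (g has_derivative (\<lambda>v. E v x)) (at x))"
    by blast
  then show ?case
    by (intro exI[of _ "\<lambda>v x. D v x + E v x"])
      (auto intro!: bracket_polynomial.add has_derivative_add)
next
  case (mult f g)
  then obtain D E where
    "\<forall>v. bracket_polynomial (D v) \<and> (\<forall>x. (f has_derivative (\<lambda>v. D v x)) (at x))"
    "\<forall>v. bracket_polynomial (E v) \<and> (\<forall>x. (g has_derivative (\<lambda>v. E v x)) (at x))"
    by blast
  with mult.hyps show ?case
    by (intro exI[of _ "\<lambda>v x. f x * E v x + D v x * g x"])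
      (auto intro!: bracket_polynomial.add bracket_polynomial.mult has_derivative_mult)
qed

text \<open>\<open>frechet_derivative\<close> relative to \<open>S\<close> is a choice, controlled
  only at points of \<open>S\<close> and only where derivatives are unique. Hence the assumption
  \<open>unique\<close>, and an induction over functions \<open>f\<close> that merely agree on
  \<open>S\<close> with a member \<open>f0\<close> of the class.\<close>

lemma Ck_on_bracket_polynomial:
  fixes f f0 :: "'a::real_inner \<Rightarrow> real"
  assumes unique: "\<And>x (\<phi> :: 'a \<Rightarrow> real) A B. x \<in> S \<Longrightarrow> (\<phi> has_derivative A) (at x within S) \<Longrightarrow>
      (\<phi> has_derivative B) (at x within S) \<Longrightarrow> A = B"
    and "bracket_polynomial f0" and "\<And>x. x \<in> S \<Longrightarrow> f x = f0 x"
  shows "Ck_on k S f"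
  using assms(2,3)
proof (induction k arbitrary: f f0)
  case (0 f f0)
  obtain D where "\<forall>v. bracket_polynomial (D v) \<and> (\<forall>x. (f0 has_derivative (\<lambda>v. D v x)) (at x))"
    using bracket_polynomial_has_derivative[OF 0(1)] by blast
  then have "continuous_on S f0"
    by (meson continuous_at_imp_continuous_on has_derivative_continuous)
  then show ?case
    using 0(2) by (simp cong: continuous_on_cong)
next
  case (Suc k f f0)
  obtain D where D: "\<And>v. bracket_polynomial (D v)"
    "\<And>x. (f0 has_derivative (\<lambda>v. D v x)) (at x)"
    using bracket_polynomial_has_derivative[OF Suc.prems(1)] by blast
  have der: "(f has_derivative (\<lambda>v. D v x)) (at x within S)" if "x \<in> S" for x
    using has_derivative_transform[OF that Suc.prems(2) has_derivative_at_withinI[OF D(2)]]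
    by blast
  then have "frechet_derivative f (at x within S) = (\<lambda>v. D v x)" if "x \<in> S" for x
    using that unique frechet_derivative_works differentiableI by metis
  then have "Ck_on k S (\<lambda>x. frechet_derivative f (at x within S) v)" for v
    using Suc.IH[OF D(1)[of v]] by auto
  moreover have "f differentiable_on S"
    using der by (auto simp: differentiable_on_def intro: differentiableI)
  ultimately show ?case
    by simp
qed

lemma smooth_on_UNIV_bracket_polynomial:
  "bracket_polynomial f \<Longrightarrow> smooth_on UNIV f"
  unfolding smooth_on_def
  by (intro allI Ck_on_bracket_polynomial) (auto intro: has_derivative_unique)

text \<open>Derivatives relative to the half-line are unique, even at its endpoint, because each of
  its points \<open>x\<close> comes with the whole interval \<open>[x, x + 1]\<close>.\<close>

lemma smooth_on_atLeast_bracket_polynomial: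
  fixes f :: "real \<Rightarrow> real"
  assumes "bracket_polynomial f"
  shows "smooth_on {c..} f"
  unfolding smooth_on_def
proof (intro allI Ck_on_bracket_polynomial[OF _ assms refl])
  fix x :: real and \<phi> A B
  assume "x \<in> {c..}"
    and A: "(\<phi> has_derivative A) (at x within {c..})"
    and B: "(\<phi> has_derivative B) (at x within {c..})"
  then have x: "x \<in> {x..x+1}" "{x..x+1} \<subseteq> {c..}" "x < x + 1" by auto
  show "A = B"
    by (rule frechet_derivative_unique_within_closed_interval[of x "x+1" x \<phi>])
      (use x A B in \<open>auto simp: intro: has_derivative_subset\<close>)
qed

section \<open>The Laplacian of a radial function\<close>

lemma partial_deriv_eqI:
  "(f has_derivative D) (at x) \<Longrightarrow> partial_deriv e f x = D e"
  unfolding partial_deriv_def using frechet_derivative_at by metis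

text \<open>The profile is a function of \<open>|x|^2\<close> rather than of \<open>|x|\<close>, so
  the chain rule also works at the origin. Summing the second derivatives over the basis turns the
  squared coordinates into \<open>x \<bullet> x\<close> and the unit vectors into the
  dimension.\<close>

lemma laplacian_radial:
  fixes K K1 K2 :: "real \<Rightarrow> real" and x :: "'a::euclidean_space"
  assumes K: "\<And>t. t \<ge> 0 \<Longrightarrow> (K has_real_derivative K1 t) (at t)"
    and K1: "\<And>t. t \<ge> 0 \<Longrightarrow> (K1 has_real_derivative K2 t) (at t)"
  shows "laplacian (\<lambda>x::'a. K (x \<bullet> x)) x
    = 4 * (x \<bullet> x) * K2 (x \<bullet> x) + 2 * real DIM('a) * K1 (x \<bullet> x)"
proof -
  have sq: "((\<lambda>x::'a. x \<bullet> x) has_derivative (\<lambda>v. 2 * (x \<bullet> v))) (at x)" for x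
    by (auto intro!: derivative_eq_intros simp: inner_commute fun_eq_iff)
  have 1: "partial_deriv e (\<lambda>x::'a. K (x \<bullet> x)) = (\<lambda>x. 2 * (x \<bullet> e) * K1 (x \<bullet> x))" for e
  proof
    fix x :: 'a
    have "((\<lambda>x::'a. K (x \<bullet> x)) has_derivative (\<lambda>v. (2 * (x \<bullet> v)) * K1 (x \<bullet> x))) (at x)"
      using has_derivative_compose[OF sq, of K "(*) (K1 (x \<bullet> x))"] K[of "x \<bullet> x"]
      by (simp add: has_field_derivative_def mult.commute)
    then show "partial_deriv e (\<lambda>x::'a. K (x \<bullet> x)) x = 2 * (x \<bullet> e) * K1 (x \<bullet> x)"
      by (rule partial_deriv_eqI)
  qed
  have 2: "partial_deriv e (\<lambda>x::'a. 2 * (x \<bullet> e) * K1 (x \<bullet> x)) x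
    = 2 * (e \<bullet> e) * K1 (x \<bullet> x) + 4 * (x \<bullet> e)\<^sup>2 * K2 (x \<bullet> x)" for e
  proof -
    have "((\<lambda>x::'a. K1 (x \<bullet> x)) has_derivative (\<lambda>v. (2 * (x \<bullet> v)) * K2 (x \<bullet> x))) (at x)"
      using has_derivative_compose[OF sq, of K1 "(*) (K2 (x \<bullet> x))"] K1[of "x \<bullet> x"]
      by (simp add: has_field_derivative_def mult.commute)
    then have "((\<lambda>x::'a. 2 * (x \<bullet> e) * K1 (x \<bullet> x)) has_derivative
      (\<lambda>v. 2 * (v \<bullet> e) * K1 (x \<bullet> x) + 4 * (x \<bullet> e) * (x \<bullet> v) * K2 (x \<bullet> x))) (at x)"
      by (auto intro!: derivative_eq_intros simp: fun_eq_iff)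
    then show ?thesis
      by (simp add: partial_deriv_eqI power2_eq_square)
  qed
  have "x \<bullet> x = (\<Sum>e\<in>Basis. (x \<bullet> e)\<^sup>2)"
    by (subst euclidean_inner) (simp add: power2_eq_square)
  then show ?thesis
    by (simp add: laplacian_def 1 2 sum.distrib sum_distrib_left sum_distrib_right)
qed

section \<open>The potential from a parametrized derivative\<close>

lemma continuous_imp_antiderivative:
  fixes f :: "real \<Rightarrow> real"
  assumes "continuous_on UNIV f"
  obtains F where "\<And>x. (F has_real_derivative f x) (at x)" "F 0 = 0"
proof -
  obtain G where "\<And>x. (G has_vector_derivative f x) (at x)"
    using einterval_antiderivative[of "-\<infinity>" "\<infinity>" f] assms
    by (auto simp: continuous_on_eq_continuous_at)
  then have "((\<lambda>x. G x - G 0) has_real_derivative f x) (at x)" for x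
    by (auto intro!: derivative_eq_intros simp: has_real_derivative_iff_has_vector_derivative)
  then show ?thesis
    using that[of "\<lambda>x. G x - G 0"] by simp
qed

text \<open>Here \<open>w = W'\<close> is prescribed along the curve \<open>s = k z\<close> by
  \<open>w (k z) = h z\<close>, and \<open>\<psi>\<close> is \<open>W''\<close> along that curve. It
  is a separate function because \<open>k'\<close> may blow up or vanish at \<open>z = 0\<close>:
  derivatives are required only for \<open>0 < z < 1\<close>, but \<open>\<psi>\<close> is
  continuous up to both ends. Since \<open>\<psi> 1 > 0\<close>, \<open>w\<close> climbs back to
  zero beyond \<open>k 1\<close>.\<close>

lemma potential_from_parametrization:
  fixes k h k' \<psi> :: "real \<Rightarrow> real"
  assumes k: "continuous_on {0..1} k" "strict_mono_on {0..1} k" "k 0 = 0"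
    and h: "continuous_on {0..1} h" "h 0 = 0" "\<And>z. 0 < z \<Longrightarrow> z \<le> 1 \<Longrightarrow> h z < 0"
    and \<psi>: "continuous_on {0..1} \<psi>" "\<psi> 1 > 0"
    and k': "\<And>z. 0 < z \<Longrightarrow> z < 1 \<Longrightarrow> (k has_real_derivative k' z) (at z)"
    and h': "\<And>z. 0 < z \<Longrightarrow> z < 1 \<Longrightarrow> (h has_real_derivative \<psi> z * k' z) (at z)"
    and lim: "((\<lambda>z. h z / k z powr p) \<longlongrightarrow> L) (at_right 0)"
  obtains W w v :: "real \<Rightarrow> real" and b :: real where
    "\<And>s. (W has_real_derivative w s) (at s)" "\<And>s. (w has_real_derivative v s) (at s)"
    "continuous_on UNIV v" "\<And>z. z \<in> {0..1} \<Longrightarrow> w (k z) = h z"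
    "k 1 < b" "w b = 0" "\<And>s. 0 < s \<Longrightarrow> s < b \<Longrightarrow> w s < 0" "v (k 1) > 0"
    "((\<lambda>s. w s / s powr p) \<longlongrightarrow> L) (at_right 0)"
proof -
  define Z where "Z = the_inv_into {0..1} k"
  \<comment> \<open>Clamping to \<open>[0, k 1]\<close>, the range of \<open>k\<close>, extends
    \<open>\<psi>\<close> composed with the inverse of \<open>k\<close> by constants on both
    sides.\<close>
  define c where "c s = max 0 (min (k 1) s)" for s :: real
  define v where "v s = \<psi> (Z (c s))" for s
  have inj: "inj_on k {0..1}"
    using k(2) strict_mono_on_imp_inj_on by blast
  have k1: "k 1 > 0"
    using strict_mono_onD[OF k(2), of 0 1] k(3) by simp
  have mono: "k y \<le> k z" if "0 \<le> y" "y \<le> z" "z \<le> 1" for y z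
    using strict_mono_on_leD[OF k(2), of y z] that by auto
  have img: "k ` {0..1} = {0..k 1}"
  proof
    show "k ` {0..1} \<subseteq> {0..k 1}"
      using mono k(3) by fastforce
    show "{0..k 1} \<subseteq> k ` {0..1}"
      using IVT'[of k 0 _ 1] k(1,3) by fastforce
  qed
  have Zk: "Z (k z) = z" if "z \<in> {0..1}" for z
    unfolding Z_def using the_inv_into_f_f[OF inj that] .
  have kZ: "k (Z s) = s" "Z s \<in> {0..1}" if "s \<in> {0..k 1}" for s
    using that f_the_inv_into_f[OF inj] the_inv_into_into[OF inj, of s "{0..1}"]
    unfolding Z_def img by auto
  have contZ: "continuous_on {0..k 1} Z"
    using continuous_on_inv[OF k(1) compact_Icc, of Z] Zk img by auto
  have c: "c s \<in> {0..k 1}" for s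
    using k1 by (auto simp: c_def)
  have contc: "continuous_on UNIV c"
    unfolding c_def by (intro continuous_intros)
  have contv: "continuous_on UNIV v"
    unfolding v_def
  proof (rule continuous_on_compose2[OF \<psi>(1)])
    show "continuous_on UNIV (\<lambda>s. Z (c s))"
      by (rule continuous_on_compose2[OF contZ contc]) (use c in auto)
  qed (use c kZ in auto)
  obtain w where w: "\<And>s. (w has_real_derivative v s) (at s)" "w 0 = 0"
    using continuous_imp_antiderivative[OF contv] by blast
  have contw: "continuous_on A w" for A
    using w(1) by (meson DERIV_isCont continuous_at_imp_continuous_on)
  obtain W where W: "\<And>s. (W has_real_derivative w s) (at s)"
    using continuous_imp_antiderivative[OF contw] by blast
  have vk: "v (k z) = \<psi> z" if "z \<in> {0..1}" for z
  proof -
    have "k z \<in> {0..k 1}"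
      using that img by blast
    then have "c (k z) = k z"
      by (simp add: c_def)
    then show ?thesis using Zk[OF that] by (simp add: v_def)
  qed
  have wk: "w (k z) = h z" if "z \<in> {0..1}" for z
  proof -
    \<comment> \<open>Both terms have derivative \<open>\<psi> y * k' y\<close> inside the interval;
      their difference is constant, and it vanishes at \<open>z = 0\<close>.\<close>
    have "w (k z) - h z = w (k 0) - h 0"
    proof (cases "z = 0")
      case False
      show ?thesis
      proof (rule DERIV_isconst_end[of 0 z "\<lambda>z. w (k z) - h z"])
        show "0 < z" using that False by auto
        show "continuous_on {0..z} (\<lambda>z. w (k z) - h z)"
          by (intro continuous_intros continuous_on_compose2[OF contw[of UNIV]]
              continuous_on_subset[OF k(1)] continuous_on_subset[OF h(1)]) (use that in auto)
      next
        fix y assume y: "0 < y" "y < z"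
        then have "y \<in> {0..1}" using that by auto
        then have "((\<lambda>z. w (k z)) has_real_derivative \<psi> y * k' y) (at y)"
          using DERIV_chain2[OF w(1) k', of y] y that vk by simp
        from DERIV_diff[OF this h'[of y]] y that
        show "((\<lambda>z. w (k z) - h z) has_real_derivative 0) (at y)"
          by auto
      qed
    qed simp
    then show ?thesis using k h w by simp
  qed
  have lin: "w s = h 1 + \<psi> 1 * (s - k 1)" if "s > k 1" for s
  proof -
    obtain \<xi> where "\<xi> > k 1" "w s - w (k 1) = (s - k 1) * v \<xi>"
      using MVT2[OF \<open>k 1 < s\<close>, of w v] w(1) by auto
    moreover have "v \<xi> = \<psi> 1" if "\<xi> > k 1"
      using that k1 Zk[of 1] by (simp add: v_def c_def)
    ultimately show ?thesis using wk[of 1] by (simp add: algebra_simps)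
  qed
  \<comment> \<open>The zero of the affine function in \<open>lin\<close>; it lies to the right of
    \<open>k 1\<close> because \<open>h 1 < 0 < \<psi> 1\<close>.\<close>
  define b where "b = k 1 - h 1 / \<psi> 1"
  have b: "k 1 < b"
    using h(3)[of 1] \<psi>(2) by (simp add: b_def divide_neg_pos)
  show thesis
  proof (rule that[of W w v b])
    show "w b = 0"
      using lin[OF b] \<psi>(2) by (simp add: b_def)
    show "w s < 0" if s: "0 < s" "s < b" for s
    proof (cases "s \<le> k 1")
      case True
      then have "s \<in> {0..k 1}" using s by auto
      from kZ[OF this] have "w s = h (Z s)" "Z s \<noteq> 0" "Z s \<in> {0..1}"
        using wk s k(3) by force+
      then show ?thesis using h(3)[of "Z s"] by auto
    next
      case False
      have "\<psi> 1 * (s - k 1) < \<psi> 1 * (b - k 1)"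
        using \<psi>(2) s by simp
      also have "\<dots> = - h 1" using \<psi>(2) by (simp add: b_def)
      finally show ?thesis using lin False by simp
    qed
    \<comment> \<open>The inverse tends to 0 through positive values, so the limit assumed in
      \<open>z\<close> transfers to \<open>s\<close>.\<close>
    have "filterlim Z (at_right 0) (at_right 0)"
    proof -
      have ev: "eventually (\<lambda>s. s \<in> {0<..<k 1}) (at_right 0)"
        using k1 by (rule eventually_at_right_real)
      have "(Z \<longlongrightarrow> Z 0) (at 0 within {0..k 1})"
        using contZ k1 by (auto simp: continuous_on_def)
      then have "(Z \<longlongrightarrow> 0) (at_right 0)"
        using Zk[of 0] k(3) k1 by (simp add: at_within_Icc_at_right)
      moreover have "eventually (\<lambda>s. Z s \<in> {0<..} \<and> Z s \<noteq> 0) (at_right 0)"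
        using ev
      proof eventually_elim
        case (elim s)
        then have s: "s \<in> {0..k 1}" by auto
        have "Z s \<noteq> 0" using kZ(1)[OF s] k(3) elim by force
        then show ?case using kZ(2)[OF s] by auto
      qed
      ultimately show ?thesis
        by (simp add: filterlim_at)
    qed
    from filterlim_compose[OF lim this]
    show "((\<lambda>s. w s / s powr p) \<longlongrightarrow> L) (at_right 0)"
    proof (rule Lim_transform_eventually)
      have "eventually (\<lambda>s. s \<in> {0<..<k 1}) (at_right 0)"
        using k1 by (rule eventually_at_right_real)
      then show "eventually (\<lambda>s. h (Z s) / k (Z s) powr p = w s / s powr p) (at_right 0)"
      proof eventually_elim
        case (elim s)
        then have s: "s \<in> {0..k 1}" by auto
        show ?case using kZ[OF s] wk[of "Z s"] by simp
      qed
    qed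
  qed (use W w contv wk b vk[of 1] \<psi>(2) in auto)
qed

text \<open>\<open>Ck_on\<close> tests every direction; on the line a direction is just a constant
  factor, so two differentiations lead to \<open>v s * x * y\<close>.\<close>

lemma Ck_on_2_UNIV_realI:
  fixes W w v :: "real \<Rightarrow> real"
  assumes "\<And>s. (W has_real_derivative w s) (at s)" "\<And>s. (w has_real_derivative v s) (at s)"
    and "continuous_on UNIV v"
  shows "Ck_on 2 UNIV W"
proof -
  have fd: "frechet_derivative f (at s) = (\<lambda>x. f' * x)"
    if "(f has_real_derivative f') (at s)" for f :: "real \<Rightarrow> real" and f' s
    using frechet_derivative_at that unfolding has_field_derivative_def by metis
  have 1: "frechet_derivative W (at s) x = w s * x" for s x
    using fd[OF assms(1)] by simp
  have d: "((\<lambda>s. w s * x) has_real_derivative v s * x) (at s)" for x s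
    by (auto intro!: derivative_eq_intros assms(2))
  have 2: "frechet_derivative (\<lambda>s. w s * x) (at s) y = v s * x * y" for s x y
    using fd[OF d] by simp
  have diff: "f differentiable_on UNIV" if "\<And>s. (f has_real_derivative f' s) (at s)"
    for f f' :: "real \<Rightarrow> real"
    using that unfolding differentiable_on_def
    by (meson differentiableI has_field_derivative_def has_field_derivative_at_within)
  have "Ck_on (Suc (Suc 0)) UNIV W"
    by (auto simp: 1 2 intro!: continuous_intros assms(3) diff[OF assms(1)] diff[OF d])
  then show ?thesis by (simp add: numeral_2_eq_2)
qed

section \<open>The explicit solution and its potential\<close>

theorem lemma2p3:
  fixes p lam :: real
  assumes "CARD('n::finite) \<ge> 3"
    and "p > real CARD('n) / (real CARD('n) - 2)"
    and "lam > 0"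
  shows "\<exists>(a::real) (b::real) (W :: real \<Rightarrow> real) (u :: real ^ 'n \<Rightarrow> real).
      a < b
    \<and> Ck_on 2 UNIV W
    \<and> deriv W a = 0 \<and> deriv W b = 0
    \<and> (\<forall>s\<in>{a<..<b}. deriv W s < 0)
    \<and> smooth_on UNIV u
    \<and> (\<forall>x. laplacian u x = deriv W (u x))
    \<and> ((\<lambda>s. deriv W s / \<bar>s - a\<bar> powr p) \<longlongrightarrow> - lam) (at_right a)
    \<and> (\<exists>g :: real \<Rightarrow> real. smooth_on {0..} g \<and> strict_antimono_on {0..} g
          \<and> g ` {0..} \<subseteq> {a<..<b} \<and> (\<forall>x. u x = g (norm x)))
    \<and> range u \<subseteq> {a<..<b} \<and> (u \<longlongrightarrow> a) at_infinity
    \<and> deriv (deriv W) (u 0) > 0"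
proof -
  define N where "N = real CARD('n)"
  define \<beta> where "\<beta> = 1 / (p - 1)"
  \<comment> \<open>Two constraints: \<open>\<epsilon> < 1\<close> keeps \<open>k\<close> increasing
    on \<open>[0, 1]\<close>, and \<open>\<epsilon> > (\<beta> + 1) / (\<beta> + 2)\<close> is what
    \<open>\<psi> 1 > 0\<close> requires. Shifting that fraction by one satisfies both.\<close>
  define \<epsilon> where "\<epsilon> = (\<beta> + 2) / (\<beta> + 3)"
  \<comment> \<open>\<open>A\<close>, \<open>B\<close> and \<open>-D\<close> are the coefficients of
    \<open>-\<Delta>u / C\<close> in the powers \<open>\<beta> + 1\<close>,
    \<open>\<beta> + 2\<close>, \<open>\<beta> + 3\<close> of \<open>z\<close>, obtained by
    substituting \<open>|x|^2 = 1 / z - 1\<close>.\<close>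
  define A where "A = 2 * N - 4 * \<beta> - 4"
  define D where "D = 4 * \<epsilon> * (\<beta> + 2)"
  define B where "B = D + 4 * (\<beta> + 1) - 2 * N * \<epsilon>"
  \<comment> \<open>As \<open>z \<rightarrow> 0\<close>, \<open>h / k^p\<close> tends to
    \<open>- C^(1 - p) * A * \<beta>^p\<close>; this \<open>C\<close> makes the limit equal to
    \<open>- lam\<close>.\<close>
  define C where "C = (A * \<beta> powr p / lam) powr \<beta>"
  define k where "k z = C * (z powr \<beta> / \<beta> - \<epsilon> * z powr (\<beta> + 1) / (\<beta> + 1))" for z
  define k' where "k' z = C * z powr (\<beta> - 1) * (1 - \<epsilon> * z)" for z
  define h where "h z = - C * (A * z powr (\<beta> + 1) + B * z powr (\<beta> + 2) - D * z powr (\<beta> + 3))" for z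
  \<comment> \<open>This is \<open>h' / k'\<close> with the factor
    \<open>C * z powr (\<beta> - 1)\<close> cancelled, hence continuous at \<open>z = 0\<close> as
    well.\<close>
  define \<psi> where "\<psi> z = - (A * (\<beta> + 1) * z + B * (\<beta> + 2) * z\<^sup>2 - D * (\<beta> + 3) * z ^ 3) / (1 - \<epsilon> * z)" for z

  \<comment> \<open>Signs of the constants\<close>
  have N: "N \<ge> 3" using assms(1) by (simp add: N_def)
  have p: "p - 1 > 2 / (N - 2)"
    using assms(2) N by (simp add: N_def field_simps)
  moreover have "2 / (N - 2) > 0" using N by simp
  ultimately have p1: "p > 1" by linarith
  then have \<beta>: "\<beta> > 0" by (simp add: \<beta>_def)
  \<comment> \<open>Dividing by \<open>p - 1\<close> gives \<open>2 * \<beta> < N - 2\<close>, and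
    \<open>A\<close> is twice the gap.\<close>
  have "2 < (p - 1) * (N - 2)"
    using p N by (simp add: field_simps)
  then have A: "A > 0"
    using p1 by (simp add: A_def \<beta>_def field_simps)
  have \<epsilon>: "0 < \<epsilon>" "\<epsilon> < 1" using \<beta> by (auto simp: \<epsilon>_def)
  have D: "D > 0" using \<epsilon> \<beta> by (simp add: D_def)
  have \<beta>p: "\<beta> * p = \<beta> + 1" using p1 by (simp add: \<beta>_def field_simps)
  have C: "C > 0" using A \<beta> assms(3) by (simp add: C_def)
  have Cp: "C powr p = C * (A * \<beta> powr p / lam)"
  proof -
    have "C powr p = C powr 1 * C powr (p - 1)"
      by (subst powr_add[symmetric]) simp
    also have "C powr (p - 1) = A * \<beta> powr p / lam"
      using p1 A \<beta> assms(3) by (simp add: C_def powr_powr \<beta>_def)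
    finally show ?thesis using C by simp
  qed
  have den: "1 - \<epsilon> * z > 0" if "0 \<le> z" "z \<le> 1" for z
  proof -
    have "\<epsilon> * z \<le> \<epsilon> * 1" using that \<epsilon> by (intro mult_left_mono) auto
    then show ?thesis using \<epsilon> by linarith
  qed

  \<comment> \<open>Properties of the parametrization\<close>
  have k0: "k 0 = 0" and h0: "h 0 = 0" by (auto simp: k_def h_def)
  \<comment> \<open>The convention \<open>0 powr s = 0\<close> agrees with the limit at 0, since all
    exponents here are positive.\<close>
  have contk: "continuous_on {0..1} k" and conth: "continuous_on {0..1} h"
    unfolding k_def[abs_def] h_def[abs_def] using \<beta>
    by (auto intro!: continuous_intros continuous_on_powr')
  have k': "(k has_real_derivative k' z) (at z)" if "0 < z" for z
  proof -
    have "(k has_real_derivative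
        C * (\<beta> * z powr (\<beta> - 1) / \<beta> - \<epsilon> * ((\<beta> + 1) * z powr \<beta>) / (\<beta> + 1))) (at z)"
      unfolding k_def[abs_def] using has_real_derivative_powr[OF that, of \<beta>]
        has_real_derivative_powr[OF that, of "\<beta> + 1"]
      by (intro DERIV_cmult DERIV_diff DERIV_cdivide) simp_all
    also have "C * (\<beta> * z powr (\<beta> - 1) / \<beta> - \<epsilon> * ((\<beta> + 1) * z powr \<beta>) / (\<beta> + 1))
        = C * (z powr (\<beta> - 1) - \<epsilon> * z powr \<beta>)"
      using \<beta> by (simp add: divide_simps)
    also have "\<dots> = k' z"
      using that by (simp add: k'_def powr_diff field_simps)
    finally show ?thesis .
  qed
  have k'_pos: "k' z > 0" if "0 < z" "z \<le> 1" for z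
    using that C den by (simp add: k'_def)
  have monok: "strict_mono_on {0..1} k"
  proof (rule strict_mono_onI)
    fix r s :: real assume "r \<in> {0..1}" "s \<in> {0..1}" "r < s"
    then show "k r < k s"
      by (intro DERIV_pos_imp_increasing_open[of r s k])
        (force intro: k' k'_pos continuous_on_subset[OF contk])+
  qed
  have h': "(h has_real_derivative \<psi> z * k' z) (at z)" if z: "0 < z" "z < 1" for z
  proof -
    have "(h has_real_derivative - C * (A * ((\<beta> + 1) * z powr \<beta>)
        + B * ((\<beta> + 2) * z powr (\<beta> + 1)) - D * ((\<beta> + 3) * z powr (\<beta> + 2)))) (at z)"
      unfolding h_def[abs_def] using has_real_derivative_powr[OF z(1), of "\<beta> + 1"]
        has_real_derivative_powr[OF z(1), of "\<beta> + 2"] has_real_derivative_powr[OF z(1), of "\<beta> + 3"]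
      by (intro DERIV_cmult DERIV_diff DERIV_add) (simp_all add: add.commute)
    also have "- C * (A * ((\<beta> + 1) * z powr \<beta>)
        + B * ((\<beta> + 2) * z powr (\<beta> + 1)) - D * ((\<beta> + 3) * z powr (\<beta> + 2)))
      = C * z powr (\<beta> - 1)
        * - (A * (\<beta> + 1) * z + B * (\<beta> + 2) * z\<^sup>2 - D * (\<beta> + 3) * z ^ 3)"
    proof -
      have "z powr \<beta> = z powr (\<beta> - 1) * z" "z powr (\<beta> + 1) = z powr (\<beta> - 1) * z\<^sup>2"
        "z powr (\<beta> + 2) = z powr (\<beta> - 1) * z ^ 3"
        using z by (simp_all add: powr_diff powr_add power2_eq_square power3_eq_cube)
      then show ?thesis by (simp only:) (simp add: algebra_simps)
    qed
    also have "\<dots> = \<psi> z * k' z"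
      using den[of z] z by (simp add: \<psi>_def k'_def)
    finally show ?thesis .
  qed
  have cont\<psi>: "continuous_on {0..1} \<psi>"
    unfolding \<psi>_def[abs_def]
    by (intro continuous_intros ballI) (use den in force)
  have \<psi>1: "\<psi> 1 > 0"
  proof -
    \<comment> \<open>This is \<open>(\<beta> + 2)^2 = (\<beta> + 1) * (\<beta> + 3) + 1\<close>
      divided by \<open>\<beta> + 3\<close>; the excess over \<open>\<beta> + 1\<close> decides the
      sign of \<open>\<psi> 1\<close>.\<close>
    have e: "\<epsilon> * (\<beta> + 2) = \<beta> + 1 + 1 / (\<beta> + 3)"
      using \<beta> by (simp add: \<epsilon>_def divide_simps) (simp add: algebra_simps)
    have "A * (\<beta> + 1) + B * (\<beta> + 2) - D * (\<beta> + 3)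
        = (2 * N + 4) * (\<beta> + 1) - (2 * N + 4) * (\<epsilon> * (\<beta> + 2))"
      by (simp add: A_def B_def D_def algebra_simps)
    also have "\<dots> = - ((2 * N + 4) / (\<beta> + 3))"
      unfolding e by (simp add: ring_distribs)
    also have "\<dots> < 0" using N \<beta> by simp
    finally show ?thesis using \<epsilon> by (simp add: \<psi>_def)
  qed
  have hneg: "h z < 0" if z: "0 < z" "z \<le> 1" for z
  proof -
    \<comment> \<open>In this grouping every term is nonnegative on \<open>(0, 1]\<close>, and the
      middle one is positive because \<open>\<epsilon> < 1\<close>.\<close>
    have "A + B * z - D * z\<^sup>2 = A * (1 - z) + (2 * N * (1 - \<epsilon>)) * z + D * z * (1 - z)"
      by (simp add: A_def B_def algebra_simps power2_eq_square)
    also have "\<dots> > 0"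
      using z A D N \<epsilon> by (intro add_nonneg_pos add_pos_nonneg) auto
    finally have "C * z powr (\<beta> + 1) * (A + B * z - D * z\<^sup>2) > 0"
      using C z by simp
    also have "C * z powr (\<beta> + 1) * (A + B * z - D * z\<^sup>2) = - h z"
      using z by (simp add: h_def powr_add algebra_simps power2_eq_square power3_eq_cube)
    finally show ?thesis by simp
  qed
  have lim: "((\<lambda>z. h z / k z powr p) \<longlongrightarrow> - lam) (at_right 0)"
  proof (rule Lim_transform_eventually)
    \<comment> \<open>The quotient after cancelling \<open>C * z powr (\<beta> + 1)\<close>, by
      \<open>\<beta>p\<close> and \<open>Cp\<close>; it is continuous at 0, so its limit is its
      value there.\<close>
    let ?r = "\<lambda>z. - (A + B * z - D * z\<^sup>2) /
      (A * \<beta> powr p / lam * (1 / \<beta> - \<epsilon> * z / (\<beta> + 1)) powr p)"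
    have "(?r \<longlongrightarrow> - (A + B * 0 - D * 0\<^sup>2) /
        (A * \<beta> powr p / lam * (1 / \<beta> - \<epsilon> * 0 / (\<beta> + 1)) powr p)) (at_right 0)"
      using \<beta> A assms(3) by (intro tendsto_intros) auto
    then show "(?r \<longlongrightarrow> - lam) (at_right 0)"
      using \<beta> A assms(3) by (simp add: powr_divide)
    have "eventually (\<lambda>z::real. z \<in> {0<..<1}) (at_right 0)"
      by (rule eventually_at_right_real) simp
    then show "eventually (\<lambda>z. ?r z = h z / k z powr p) (at_right 0)"
    proof eventually_elim
      case (elim z)
      define q where "q = 1 / \<beta> - \<epsilon> * z / (\<beta> + 1)"
      have k: "k z = C * z powr \<beta> * q"
        using elim by (simp add: k_def q_def powr_add algebra_simps)
      have "k z > 0"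
        using strict_mono_onD[OF monok, of 0 z] elim k0 by simp
      moreover have "C * z powr \<beta> > 0" using C elim by simp
      ultimately have "q > 0" unfolding k by (rule zero_less_mult_pos)
      then have "k z powr p = C * z powr (\<beta> + 1) * (A * \<beta> powr p / lam * q powr p)"
        using C elim by (simp add: k powr_mult powr_powr \<beta>p Cp)
      moreover have "h z = C * z powr (\<beta> + 1) * - (A + B * z - D * z\<^sup>2)"
        using elim by (simp add: h_def powr_add algebra_simps power2_eq_square power3_eq_cube)
      moreover have "C * z powr (\<beta> + 1) \<noteq> 0" using C elim by simp
      ultimately show ?case
        unfolding q_def by (metis mult_divide_mult_cancel_left)
    qed
  qed

  obtain W w v b where W: "\<And>s. (W has_real_derivative w s) (at s)"
    and w: "\<And>s. (w has_real_derivative v s) (at s)"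
    and v: "continuous_on UNIV v"
    and wk: "\<And>z. z \<in> {0..1} \<Longrightarrow> w (k z) = h z"
    and b: "k 1 < b" "w b = 0" and wneg: "\<And>s. 0 < s \<Longrightarrow> s < b \<Longrightarrow> w s < 0"
    and vk: "v (k 1) > 0"
    and wlim: "((\<lambda>s. w s / s powr p) \<longlongrightarrow> - lam) (at_right 0)"
    by (rule potential_from_parametrization[OF contk monok k0 conth h0 hneg cont\<psi> \<psi>1 k' h' lim];
      (assumption | (rule that; assumption)))
  have dW: "deriv W = w" and dw: "deriv w = v"
    using W w by (auto intro!: DERIV_imp_deriv ext)

  \<comment> \<open>The solution as a function of \<open>t = |x|^2\<close>, with
    \<open>z = 1 / (1 + t)\<close>\<close>
  define K where "K t = C * ((1 + t) powr (- \<beta>) / \<beta> - \<epsilon> * (1 + t) powr (- \<beta> - 1) / (\<beta> + 1))" for t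
  define K1 where "K1 t = C * (\<epsilon> * (1 + t) powr (- \<beta> - 2) - (1 + t) powr (- \<beta> - 1))" for t
  define K2 where "K2 t = C * ((\<beta> + 1) * (1 + t) powr (- \<beta> - 2)
      - \<epsilon> * (\<beta> + 2) * (1 + t) powr (- \<beta> - 3))" for t
  define u where "u x = K (x \<bullet> x)" for x :: "real ^ 'n"
  define g where "g r = K (r \<bullet> r)" for r :: real
  have inv_powr: "(1 / (1 + t)) powr s = (1 + t) powr (- s)" if "t \<ge> 0" for s t :: real
    using that by (simp add: powr_divide powr_minus_divide)
  have Kk: "K t = k (1 / (1 + t))" if "t \<ge> 0" for t
    using inv_powr[OF that] by (simp add: K_def k_def)
  have dpowr: "((\<lambda>t. (1 + t) powr s) has_real_derivative s * (1 + t) powr r) (at t)"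
    if "t \<ge> 0" "r = s - 1" for s r t :: real
    using that by (auto intro!: derivative_eq_intros)
  have K1: "(K has_real_derivative K1 t) (at t)" if "t \<ge> 0" for t
  proof -
    have "(K has_real_derivative C * ((- \<beta>) * (1 + t) powr (- \<beta> - 1) / \<beta>
        - \<epsilon> * ((- \<beta> - 1) * (1 + t) powr (- \<beta> - 2)) / (\<beta> + 1))) (at t)"
      unfolding K_def[abs_def] using that
      by (intro DERIV_cmult DERIV_diff DERIV_cdivide dpowr) auto
    also have "C * ((- \<beta>) * (1 + t) powr (- \<beta> - 1) / \<beta>
        - \<epsilon> * ((- \<beta> - 1) * (1 + t) powr (- \<beta> - 2)) / (\<beta> + 1)) = K1 t"
    proof -
      have "(- \<beta> - 1) / (\<beta> + 1) = - 1" using \<beta> by (simp add: field_simps)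
      then have "\<epsilon> * ((- \<beta> - 1) * y) / (\<beta> + 1) = - (\<epsilon> * y)" for y
        by (metis mult_minus1 mult_minus_right times_divide_eq_left times_divide_eq_right)
      then show ?thesis using \<beta> by (simp add: K1_def)
    qed
    finally show ?thesis .
  qed
  have K2: "(K1 has_real_derivative K2 t) (at t)" if "t \<ge> 0" for t
  proof -
    have "(K1 has_real_derivative C * (\<epsilon> * ((- \<beta> - 2) * (1 + t) powr (- \<beta> - 3))
        - (- \<beta> - 1) * (1 + t) powr (- \<beta> - 2))) (at t)"
      unfolding K1_def[abs_def] using that
      by (intro DERIV_cmult DERIV_diff dpowr) auto
    also have "C * (\<epsilon> * ((- \<beta> - 2) * (1 + t) powr (- \<beta> - 3))
        - (- \<beta> - 1) * (1 + t) powr (- \<beta> - 2)) = K2 t"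
      by (simp add: K2_def algebra_simps)
    finally show ?thesis .
  qed
  have lap: "laplacian u x = w (u x)" for x
  proof -
    define t where "t = x \<bullet> x"
    have t: "t \<ge> 0" by (simp add: t_def)
    \<comment> \<open>With the lowest power factored out, both sides become polynomials in
      \<open>t\<close> times \<open>q\<close>, and the equation is an identity of
      polynomials.\<close>
    define q where "q = (1 + t) powr (- \<beta> - 3)"
    have q: "(1 + t) powr (- \<beta> - 2) = (1 + t) * q" "(1 + t) powr (- \<beta> - 1) = (1 + t)\<^sup>2 * q"
      using t powr_add[of "1 + t" 1 "- \<beta> - 3"] powr_add[of "1 + t" 2 "- \<beta> - 3"]
      by (simp_all add: q_def minus_diff_commute)
    have "laplacian u x = 4 * t * K2 t + 2 * N * K1 t"
      unfolding u_def[abs_def] t_def N_def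
      using laplacian_radial[OF K1 K2, where 'a = "real ^ 'n"] by simp
    also have "\<dots> = - C * (A * (1 + t) powr (- \<beta> - 1) + B * (1 + t) powr (- \<beta> - 2)
        - D * (1 + t) powr (- \<beta> - 3))"
      unfolding K1_def K2_def A_def B_def D_def q q_def[symmetric]
      by (simp add: algebra_simps power2_eq_square)
    also have "\<dots> = h (1 / (1 + t))"
      using inv_powr[OF t] by (simp add: h_def)
    also have "\<dots> = w (k (1 / (1 + t)))"
      using t by (intro wk[symmetric]) auto
    finally show ?thesis
      using Kk[OF t] by (simp add: u_def t_def)
  qed
  have bp: "bracket_polynomial u" "bracket_polynomial g"
  proof -
    \<comment> \<open>Expanded into constants times powers, \<open>K\<close> matches the
      introduction rules, for vectors and for reals alike.\<close>
    have K: "K t = C / \<beta> * (1 + t) powr (- \<beta>) + (- C * \<epsilon> / (\<beta> + 1)) * (1 + t) powr (- \<beta> - 1)" for t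
      by (simp add: K_def algebra_simps)
    show "bracket_polynomial u" "bracket_polynomial g"
      unfolding u_def[abs_def] g_def[abs_def] K by (intro bracket_polynomial.intros)+
  qed
  have range: "K t \<in> {0<..<b}" if "t \<ge> 0" for t
  proof -
    have "k 0 < k (1 / (1 + t))"
      by (rule strict_mono_onD[OF monok]) (use that in auto)
    moreover have "k (1 / (1 + t)) \<le> k 1"
      by (rule strict_mono_on_leD[OF monok]) (use that in auto)
    ultimately show ?thesis
      using k0 b Kk[OF that] by auto
  qed
  have anti: "strict_antimono_on {0..} g"
  proof (rule monotone_onI)
    fix r s :: real assume rs: "r \<in> {0..}" "s \<in> {0..}" "r < s"
    then have "r * r < s * s" by (auto intro: mult_strict_mono')
    then have "1 / (1 + s * s) < 1 / (1 + r * r)"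
      by (intro divide_strict_left_mono) (auto simp: add_pos_nonneg)
    moreover have "1 / (1 + y * y) \<in> {0..1}" for y :: real
      by (simp add: divide_le_eq_1 add_pos_nonneg)
    ultimately have "k (1 / (1 + s * s)) < k (1 / (1 + r * r))"
      using strict_mono_onD[OF monok] by blast
    then show "g r > g s"
      by (simp add: g_def Kk)
  qed
  have ulim: "(u \<longlongrightarrow> 0) at_infinity"
  proof -
    have "filterlim (\<lambda>x::real ^ 'n. (norm x)\<^sup>2) at_top at_infinity"
      by (rule filterlim_pow_at_top[OF _ filterlim_norm_at_top]) simp
    then have "filterlim (\<lambda>x::real ^ 'n. 1 + x \<bullet> x) at_top at_infinity"
      by (intro filterlim_tendsto_add_at_top[OF tendsto_const]) (simp add: power2_norm_eq_inner)
    then have "((\<lambda>x::real ^ 'n. (1 + x \<bullet> x) powr s) \<longlongrightarrow> 0) at_infinity" if "s < 0" for s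
      using that by (rule tendsto_neg_powr[rotated])
    then have "(u \<longlongrightarrow> C * (0 / \<beta> - \<epsilon> * 0 / (\<beta> + 1))) at_infinity"
      unfolding u_def[abs_def] K_def using \<beta> by (intro tendsto_intros) auto
    then show ?thesis by simp
  qed
  show ?thesis
  proof (rule exI[of _ 0], rule exI[of _ b], rule exI[of _ W], rule exI[of _ u],
      intro conjI exI[of _ g])
    show "0 < b" using range[of 0] by auto
    show "Ck_on 2 UNIV W" using Ck_on_2_UNIV_realI W w v by blast
    show "deriv W 0 = 0" using wk[of 0] k0 h0 dW by simp
    show "deriv W b = 0" using b dW by simp
    show "\<forall>s\<in>{0<..<b}. deriv W s < 0" using wneg dW by simp
    show "smooth_on UNIV u" "smooth_on {0..} g"
      using bp smooth_on_UNIV_bracket_polynomial smooth_on_atLeast_bracket_polynomial by blast+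
    show "\<forall>x. laplacian u x = deriv W (u x)" using lap dW by simp
    show "((\<lambda>s. deriv W s / \<bar>s - 0\<bar> powr p) \<longlongrightarrow> - lam) (at_right 0)"
      using wlim unfolding dW
      by (rule Lim_transform_eventually) (auto simp: eventually_at_filter)
    show "strict_antimono_on {0..} g" by (rule anti)
    show "g ` {0..} \<subseteq> {0<..<b}" using range by (auto simp: g_def)
    show "\<forall>x. u x = g (norm x)"
      by (simp add: u_def g_def flip: power2_eq_square power2_norm_eq_inner)
    show "range u \<subseteq> {0<..<b}" using range by (auto simp: u_def)
    show "(u \<longlongrightarrow> 0) at_infinity" by (rule ulim)
    \<comment> \<open>The origin corresponds to \<open>z = 1\<close>, so
      \<open>u 0 = k 1\<close>.\<close>
    show "deriv (deriv W) (u 0) > 0"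
      using vk Kk[of 0] dW dw by (simp add: u_def)
  qed
qed

end
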